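(* Let $A,B,C,D\in\mathbb{R}$ with $AD-BC=1$, let $S=\begin{pmatrix}A&B\\C&D\end{pmatrix}\in \mathrm{Sp}(1,\mathbb{R})$, and let $\hat S$ be a metaplectic operator on $L^2(\mathbb{R})$ with projection $S$. Then the Schwartz kernel $k\in\mathcal{S}'(\mathbb{R}^2)$ of $\hat S$ is quasi-diagonal if and only if $D=1$ or $C\neq 0$.
   Context: Metaplectic operators. For $(x,\xi;\tau)\in\mathbb{R}^d\times\mathbb{R}^d\times\mathbb{R}$ and $f\in L^2(\mathbb{R}^d)$ let $\rho(x,\xi;\tau)f(t)=e^{2\pi i\tau}e^{-i\pi x\cdot\xi}e^{2\pi i\xi\cdot t}f(t-x)$ (here $d=1$). For $S\in\mathrm{Sp}(d,\mathbb{R})$, a metaplectic operator with projection $S$ is a unitary operator $\hat S$ on $L^2(\mathbb{R}^d)$ with $\hat S\rho(x,\xi;\tau)\hat S^{-1}=\rho(S(x,\xi);\tau)$ for all $(x,\xi;\tau)$; it exists and is unique up to a phase factor (a complex constant of modulus $1$). $\hat S$ maps $\mathcal{S}(\mathbb{R}^d)$ to $\mathcal{S}(\mathbb{R}^d)$ continuously. Schwartz kernel. The kernel of a continuous linear $T:\mathcal{S}(\mathbb{R}^d)\to\mathcal{S}'(\mathbb{R}^d)$ is the distribution $k\in\mathcal{S}'(\mathbb{R}^{2d})$ such that, formally, $Tf(x)=\int_{\mathbb{R}^d}k(x,y)f(y)\,dy$ for $f\in\mathcal{S}(\mathbb{R}^d)$. Quasi-diagonality. Let $\langle x\rangle=(1+|x|^2)^{1/2}$.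 A continuous function $h$ on $\mathbb{R}^{2d}$ is a diagonal kernel if for every integer $N>0$ there is $C_N>0$ with $|h(x,y)|\le C_N\langle x-y\rangle^{-N}$ for all $x,y\in\mathbb{R}^d$. Let $\varphi(t)=e^{-\pi|t|^2}$, $t\in\mathbb{R}^{2d}$. A distribution $k\in\mathcal{S}'(\mathbb{R}^{2d})$ is quasi-diagonal if the smoothed kernel $\tilde k=k*\varphi$ is a diagonal kernel. *)

theory Defs
  imports "HOL-Analysis.Analysis"
begin

section \<open>Schwartz functions and tempered distributions\<close>

definition japanese :: "'a::real_normed_vector \<Rightarrow> real" where
  "japanese x = sqrt (1 + (norm x)\<^sup>2)"

fun partials :: "'a::euclidean_space list \<Rightarrow> ('a \<Rightarrow> complex) \<Rightarrow> 'a \<Rightarrow> complex" where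
  "partials [] f = f"
| "partials (v # vs) f = (\<lambda>x. frechet_derivative (partials vs f) (at x) v)"

text \<open>A multi-index of order \<open>n\<close> is encoded as a list of \<open>n\<close> basis vectors.  Differentiability of
  all iterated partial derivatives is the same as being infinitely differentiable.\<close>

definition schwartz :: "('a::euclidean_space \<Rightarrow> complex) set" where
  "schwartz = {f. \<forall>vs. set vs \<subseteq> Basis \<longrightarrow>
     (\<forall>x. partials vs f differentiable (at x)) \<and>
     (\<forall>m::nat. bounded (range (\<lambda>x. japanese x ^ m * norm (partials vs f x))))}"

definition schwartz_seminorm :: "nat \<Rightarrow> 'a::euclidean_space list \<Rightarrow> ('a \<Rightarrow> complex) \<Rightarrow> real" where
  "schwartz_seminorm m vs f = (SUP x. japanese x ^ m * norm (partials vs f x))"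

text \<open>Functionals are total functions here, but only their values on \<^const>\<open>schwartz\<close> matter.
  Continuity for the Frechet topology given by the seminorms is expressed, as usual for linear
  functionals, as domination by a finite sum of seminorms.\<close>

definition tempered_distribution :: "(('a::euclidean_space \<Rightarrow> complex) \<Rightarrow> complex) \<Rightarrow> bool" where
  "tempered_distribution u \<longleftrightarrow>
     (\<forall>f\<in>schwartz. \<forall>g\<in>schwartz. u (\<lambda>x. f x + g x) = u f + u g) \<and>
     (\<forall>c. \<forall>f\<in>schwartz. u (\<lambda>x. c * f x) = c * u f) \<and>
     (\<exists>N K. \<forall>f\<in>schwartz.
        norm (u f) \<le> K * (\<Sum>m\<le>N. \<Sum>vs | set vs \<subseteq> Basis \<and> length vs \<le> N. schwartz_seminorm m vs f))"

text \<open>The (bilinear) pairing by which functions are regarded as distributions.\<close>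

definition distribution_of :: "('a::euclidean_space \<Rightarrow> complex) \<Rightarrow> ('a \<Rightarrow> complex) \<Rightarrow> complex" where
  "distribution_of f g = (LINT x|lborel. f x * g x)"

definition distr_convolution ::
    "(('a::euclidean_space \<Rightarrow> complex) \<Rightarrow> complex) \<Rightarrow> ('a \<Rightarrow> complex) \<Rightarrow> 'a \<Rightarrow> complex" where
  "distr_convolution u \<phi> z = u (\<lambda>w. \<phi> (z - w))"

text \<open>Weak form of \<open>T f x = \<integral> k (x, y) f y dy\<close>, tested against \<open>g\<close>.\<close>

definition is_schwartz_kernel ::
    "(('a::euclidean_space \<Rightarrow> complex) \<Rightarrow> ('a \<Rightarrow> complex) \<Rightarrow> complex) \<Rightarrow>
     (('a \<times> 'a \<Rightarrow> complex) \<Rightarrow> complex) \<Rightarrow> bool" where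
  "is_schwartz_kernel T k \<longleftrightarrow> tempered_distribution k \<and>
     (\<forall>f\<in>schwartz. \<forall>g\<in>schwartz. T f g = k (\<lambda>(x, y). g x * f y))"


section \<open>Quasi-diagonality\<close>

definition diagonal_kernel :: "('a::euclidean_space \<times> 'a \<Rightarrow> complex) \<Rightarrow> bool" where
  "diagonal_kernel h \<longleftrightarrow> continuous_on UNIV h \<and>
     (\<forall>N::nat. N > 0 \<longrightarrow> (\<exists>K>0. \<forall>x y. norm (h (x, y)) \<le> K * japanese (x - y) powi (- int N)))"

definition gaussian :: "'a::euclidean_space \<Rightarrow> complex" where
  "gaussian t = complex_of_real (exp (- pi * (norm t)\<^sup>2))"

definition quasi_diagonal :: "(('a::euclidean_space \<times> 'a \<Rightarrow> complex) \<Rightarrow> complex) \<Rightarrow> bool" where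
  "quasi_diagonal k \<longleftrightarrow> diagonal_kernel (distr_convolution k gaussian)"


section \<open>Metaplectic operators\<close>

text \<open>Elements of \<open>L\<^sup>2\<close> are represented by square-integrable functions, with almost-everywhere
  equality as equality.  Operators act on representatives and have to respect it.\<close>

definition L2 :: "('a::euclidean_space \<Rightarrow> complex) set" where
  "L2 = {f \<in> borel_measurable lborel. integrable lborel (\<lambda>x. (norm (f x))\<^sup>2)}"

definition ae_eq :: "('a::euclidean_space \<Rightarrow> complex) \<Rightarrow> ('a \<Rightarrow> complex) \<Rightarrow> bool" (infix "=\<^sub>a\<^sub>e" 50) where
  "f =\<^sub>a\<^sub>e g \<longleftrightarrow> (AE x in lborel. f x = g x)"

definition L2_inner :: "('a::euclidean_space \<Rightarrow> complex) \<Rightarrow> ('a \<Rightarrow> complex) \<Rightarrow> complex" where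
  "L2_inner f g = (LINT x|lborel. f x * cnj (g x))"

definition unitary_on_L2 :: "(('a::euclidean_space \<Rightarrow> complex) \<Rightarrow> 'a \<Rightarrow> complex) \<Rightarrow> bool" where
  "unitary_on_L2 U \<longleftrightarrow>
     (\<forall>f\<in>L2. U f \<in> L2) \<and>
     (\<forall>f\<in>L2. \<forall>g\<in>L2. f =\<^sub>a\<^sub>e g \<longrightarrow> U f =\<^sub>a\<^sub>e U g) \<and>
     (\<forall>f\<in>L2. \<forall>g\<in>L2. U (\<lambda>x. f x + g x) =\<^sub>a\<^sub>e (\<lambda>x. U f x + U g x)) \<and>
     (\<forall>c. \<forall>f\<in>L2. U (\<lambda>x. c * f x) =\<^sub>a\<^sub>e (\<lambda>x. c * U f x)) \<and>
     (\<forall>f\<in>L2. \<forall>g\<in>L2. L2_inner (U f) (U g) = L2_inner f g) \<and>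
     (\<forall>g\<in>L2. \<exists>f\<in>L2. U f =\<^sub>a\<^sub>e g)"

definition rho ::
    "'a::euclidean_space \<times> 'a \<Rightarrow> real \<Rightarrow> ('a \<Rightarrow> complex) \<Rightarrow> 'a \<Rightarrow> complex" where
  "rho = (\<lambda>(x, \<xi>) \<tau> f t.
     cis (2 * pi * \<tau>) * cis (- pi * (x \<bullet> \<xi>)) * cis (2 * pi * (\<xi> \<bullet> t)) * f (t - x))"

definition symplectic_form :: "'a::euclidean_space \<times> 'a \<Rightarrow> 'a \<times> 'a \<Rightarrow> real" where
  "symplectic_form = (\<lambda>(x, \<xi>) (y, \<eta>). x \<bullet> \<eta> - \<xi> \<bullet> y)"

definition symplectic :: "('a::euclidean_space \<times> 'a \<Rightarrow> 'a \<times> 'a) \<Rightarrow> bool" where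
  "symplectic S \<longleftrightarrow> linear S \<and> (\<forall>z w. symplectic_form (S z) (S w) = symplectic_form z w)"

text \<open>In the last clause \<open>f\<close> is the preimage of \<open>g\<close> under \<open>U\<close>, so it reads
  \<open>U \<rho>(z; \<tau>) U\<^sup>-\<^sup>1 g = \<rho>(S z; \<tau>) g\<close>.\<close>

definition metaplectic ::
    "('a::euclidean_space \<times> 'a \<Rightarrow> 'a \<times> 'a) \<Rightarrow> (('a \<Rightarrow> complex) \<Rightarrow> 'a \<Rightarrow> complex) \<Rightarrow> bool" where
  "metaplectic S U \<longleftrightarrow> symplectic S \<and> unitary_on_L2 U \<and>
     (\<forall>z \<tau>. \<forall>f\<in>L2. \<forall>g\<in>L2. U f =\<^sub>a\<^sub>e g \<longrightarrow> U (rho z \<tau> f) =\<^sub>a\<^sub>e rho (S z) \<tau> g)"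

definition matrix_map :: "real \<Rightarrow> real \<Rightarrow> real \<Rightarrow> real \<Rightarrow> real \<times> real \<Rightarrow> real \<times> real" where
  "matrix_map A B C D = (\<lambda>(x, \<xi>). (A * x + B * \<xi>, C * x + D * \<xi>))"

lemma symplectic_matrix_map_iff: "symplectic (matrix_map A B C D) \<longleftrightarrow> A * D - B * C = 1"
proof
  assume "symplectic (matrix_map A B C D)"
  then have "symplectic_form (matrix_map A B C D (1, 0)) (matrix_map A B C D (0, 1))
      = symplectic_form (1, 0) (0, 1 :: real)"
    unfolding symplectic_def by blast
  then show "A * D - B * C = 1"
    by (simp add: symplectic_form_def matrix_map_def algebra_simps)
next
  assume det: "A * D - B * C = 1"
  have "linear (matrix_map A B C D)"
    by (rule linearI) (auto simp: matrix_map_def algebra_simps)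
  moreover have "symplectic_form (matrix_map A B C D z) (matrix_map A B C D w) = symplectic_form z w"
    for z w
  proof -
    have "symplectic_form (matrix_map A B C D z) (matrix_map A B C D w)
        = (A * D - B * C) * symplectic_form z w"
      by (simp add: symplectic_form_def matrix_map_def case_prod_unfold algebra_simps)
    then show ?thesis by (simp add: det)
  qed
  ultimately show "symplectic (matrix_map A B C D)"
    unfolding symplectic_def by blast
qed

end

theory Submission
  imports Defs "HOL-Probability.Characteristic_Functions"
begin

text \<open>The smoothed kernel at \<open>(x, y)\<close> is the pairing of \<open>U G\<^sub>y\<close> with \<open>G\<^sub>x\<close>, where \<open>G\<^sub>x\<close> is the Gaussian centred
  at \<open>x\<close>.  By Moyal's identity its squared modulus is a phase-space integral of
  \<open>\<langle>\<rho>(z) U G\<^sub>y, U G\<^sub>y\<rangle> = \<langle>\<rho>(S\<^sup>-\<^sup>1 z) G\<^sub>y, G\<^sub>y\<rangle>\<close> against a Gaussian, so \<open>U G\<^sub>y\<close> itself never has to be computed.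
  What remains is a two-dimensional Gaussian integral, whose value is a constant times \<open>exp (- q)\<close> for a
  positive definite quadratic form \<open>q\<close> in \<open>(A y - x, C y)\<close>.  This decays in \<open>x - y\<close> iff \<open>x - y\<close> is a linear
  combination of \<open>A y - x\<close> and \<open>C y\<close>, that is, iff \<open>C \<noteq> 0\<close> or \<open>A = D = 1\<close>; otherwise the modulus is constant
  along the line \<open>x = A y\<close>.\<close>

section \<open>Gaussian integrals\<close>

text \<open>For complex \<open>b\<close>, completing the square would move the path of integration
  off the real line. Instead \<open>Re b\<close> is absorbed by a real affine substitution, and
  \<open>Im b\<close> becomes the frequency at which the characteristic function of the standard
  normal law is evaluated.\<close>

lemma has_bochner_integral_exp_quadratic:
  fixes a :: real and b :: complex
  assumes a: "a > 0"
  shows "has_bochner_integral lborel (\<lambda>t. exp (b * of_real t - of_real (a * t\<^sup>2)))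
           (of_real (sqrt (pi / a)) * exp (b\<^sup>2 / of_real (4 * a)))"
proof -
  \<comment> \<open>With \<open>x = t0 + c * t\<close>, the scale \<open>c\<close> turns
    \<open>x\<^sup>2 / 2\<close> into a quadratic with leading term \<open>a * t\<^sup>2\<close>,
    the shift \<open>t0\<close> supplies the linear term \<open>Re b * t\<close>, and
    \<open>s * c = Im b\<close>.\<close>
  define c where "c = sqrt (2 * a)"
  have c: "c > 0" "c\<^sup>2 = 2 * a" using a by (auto simp: c_def)
  define s where "s = Im b / c"
  define t0 where "t0 = - Re b / c"
  let ?f = "\<lambda>x. std_normal_density x *\<^sub>R iexp (s * x)"
  have intd: "integrable lborel ?f"
    by (rule Bochner_Integration.integrable_bound[OF integrable_normal_density[of 1 0]]) auto
  have "(CLINT x|std_normal_distribution. iexp (s * x)) = (\<integral>x. ?f x \<partial>lborel)"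
    by (rule integral_density) auto
  then have "(\<integral>x. ?f x \<partial>lborel) = of_real (exp (- (s\<^sup>2) / 2))"
    using fun_cong[OF char_std_normal_distribution, of s] by (simp add: char_def)
  with intd have "has_bochner_integral lborel ?f (of_real (exp (- (s\<^sup>2) / 2)))"
    by (simp add: has_bochner_integral_iff)
  then have 1: "has_bochner_integral lborel (\<lambda>t. ?f (t0 + c * t)) (of_real (exp (- (s\<^sup>2) / 2)) /\<^sub>R \<bar>c\<bar>)"
    using c by (subst (asm) lborel_has_bochner_integral_real_affine_iff[of c _ _ t0]) auto
  \<comment> \<open>\<open>k\<close> undoes the normalisation of the density, the constant left by
    completing the square, and the phase \<open>s * t0\<close>.\<close>
  define k where "k = of_real (sqrt (2 * pi)) * exp (of_real ((Re b)\<^sup>2 / (4 * a)) + \<i> * of_real (Im b * Re b / (2 * a)))"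
  have 2: "k * ?f (t0 + c * t) = exp (b * of_real t - of_real (a * t\<^sup>2))" for t
  proof -
    have "t0 + c * t = (2 * a * t - Re b) / c"
      using c by (simp add: t0_def field_simps flip: power2_eq_square)
    then have "(t0 + c * t)\<^sup>2 / 2 = (2 * a * t - Re b)\<^sup>2 / (4 * a)"
      using c a by (simp add: power_divide)
    then have sq: "(t0 + c * t)\<^sup>2 / 2 = (Re b)\<^sup>2 / (4 * a) - Re b * t + a * t\<^sup>2"
      using a by (simp add: power2_eq_square field_simps)
    have st: "s * (t0 + c * t) = - (Im b * Re b / (2 * a)) + Im b * t"
      using c a by (simp add: t0_def s_def power2_eq_square[symmetric] field_simps)
    have "?f (t0 + c * t) = of_real (1 / sqrt (2 * pi))
        * (exp (of_real (- ((t0 + c * t)\<^sup>2 / 2))) * exp (\<i> * of_real (s * (t0 + c * t))))"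
      by (simp add: std_normal_density_def scaleR_conv_of_real flip: exp_of_real)
    also have "\<dots> = of_real (1 / sqrt (2 * pi)) * exp (
          of_real (- ((Re b)\<^sup>2 / (4 * a) - Re b * t + a * t\<^sup>2))
          + \<i> * of_real (- (Im b * Re b / (2 * a)) + Im b * t))"
      by (simp only: sq st mult_exp_exp)
    moreover have "complex_of_real (sqrt (2 * pi)) * of_real (1 / sqrt (2 * pi)) = 1"
      by (simp flip: of_real_mult)
    ultimately have "k * ?f (t0 + c * t) = exp ((of_real ((Re b)\<^sup>2 / (4 * a)) + \<i> * of_real (Im b * Re b / (2 * a)))
          + (of_real (- ((Re b)\<^sup>2 / (4 * a) - Re b * t + a * t\<^sup>2))
            + \<i> * of_real (- (Im b * Re b / (2 * a)) + Im b * t)))"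
      by (simp add: k_def exp_add[of
          "of_real ((Re b)\<^sup>2 / (4 * a)) + \<i> * of_real (Im b * Re b / (2 * a))"]
          del: of_real_add of_real_diff of_real_minus of_real_mult of_real_divide of_real_power)
    also have "\<dots> = exp (b * of_real t - of_real (a * t\<^sup>2))"
      by (rule arg_cong[of _ _ exp]) (simp add: complex_eq_iff algebra_simps)
    finally show ?thesis .
  qed
  \<comment> \<open>The last summand is the exponent of the characteristic function at
    \<open>s\<close>; the others are the exponent in \<open>k\<close>.\<close>
  have b2: "b\<^sup>2 / of_real (4 * a) = of_real ((Re b)\<^sup>2 / (4 * a)) + \<i> * of_real (Im b * Re b / (2 * a)) + of_real (- (s\<^sup>2 / 2))"
    using a c by (simp add: s_def power_divide complex_eq_iff Re_divide Im_divide power2_eq_square field_simps)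
  have k: "k * (of_real (exp (- (s\<^sup>2) / 2)) /\<^sub>R \<bar>c\<bar>) = of_real (sqrt (pi / a)) * exp (b\<^sup>2 / of_real (4 * a))"
  proof -
    have "sqrt (2 * pi) / c = sqrt (pi / a)"
      using a by (simp add: c_def flip: real_sqrt_divide)
    moreover have "k * (of_real (exp (- (s\<^sup>2) / 2)) /\<^sub>R \<bar>c\<bar>) = of_real (sqrt (2 * pi) / c) * exp (b\<^sup>2 / of_real (4 * a))"
      unfolding b2 exp_add[of _ "of_real (- (s\<^sup>2 / 2))"] exp_of_real
      using c by (simp add: k_def scaleR_conv_of_real field_simps)
    ultimately show ?thesis
      by simp
  qed
  show ?thesis
    using has_bochner_integral_mult_right[OF 1, of k] unfolding 2 k by simp
qed

lemma
  fixes a :: real and b c :: complex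
  assumes a: "a > 0"
  shows integrable_exp_quadratic: "integrable lborel (\<lambda>t. exp (b * of_real t - of_real (a * t\<^sup>2) + c))"
    and integral_exp_quadratic: "(LINT t|lborel. exp (b * of_real t - of_real (a * t\<^sup>2) + c))
           = of_real (sqrt (pi / a)) * exp (b\<^sup>2 / of_real (4 * a) + c)"
  using has_bochner_integral_mult_left[OF has_bochner_integral_exp_quadratic[OF a, of b], of "exp c"]
  by (simp_all add: exp_add has_bochner_integral_iff mult.assoc)

section \<open>Square-integrable functions\<close>

lemma gaussian_real: "gaussian (t::real) = exp (- of_real (pi * t\<^sup>2))"
  by (simp add: gaussian_def flip: exp_of_real)

lemma cnj_gaussian [simp]: "cnj (gaussian t) = gaussian t"
  by (simp add: gaussian_def)

lemma borel_measurable_gaussian [measurable]: "gaussian \<in> borel_measurable borel"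
  unfolding gaussian_def by measurable

lemma gaussian_at_L2: "(\<lambda>t. gaussian (x - t)) \<in> L2" for x :: real
proof -
  have "norm (exp (of_real (4 * pi * x) * of_real t - of_real (2 * pi * t\<^sup>2) + of_real (- 2 * pi * x\<^sup>2)) :: complex)
      = (norm (gaussian (x - t)))\<^sup>2" for t
    by (simp add: gaussian_real power2_eq_square algebra_simps flip: exp_add)
  moreover have "integrable lborel (\<lambda>t. norm (exp (of_real (4 * pi * x) * of_real t - of_real (2 * pi * t\<^sup>2)
      + of_real (- 2 * pi * x\<^sup>2)) :: complex))"
    by (intro integrable_norm integrable_exp_quadratic) auto
  ultimately show ?thesis
    by (simp add: L2_def)
qed

lemma L2_measurable [measurable_dest]: "f \<in> L2 \<Longrightarrow> f \<in> borel_measurable lborel"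
  by (simp add: L2_def)

lemma borel_measurable_cnj [measurable]: "cnj \<in> borel_measurable borel"
  by (intro borel_measurable_continuous_onI continuous_intros)

lemma L2_cnj: "f \<in> L2 \<Longrightarrow> (\<lambda>x. cnj (f x)) \<in> L2"
  by (auto simp: L2_def)

lemma integrable_L2_mult:
  assumes "f \<in> L2" "g \<in> L2"
  shows "integrable lborel (\<lambda>x. f x * g x)"
proof (rule Bochner_Integration.integrable_bound)
  show "integrable lborel (\<lambda>x. (norm (f x))\<^sup>2 + (norm (g x))\<^sup>2)"
    using assms by (auto simp: L2_def)
  show "(\<lambda>x. f x * g x) \<in> borel_measurable lborel"
    using assms by measurable
  have "norm (f x * g x) \<le> (norm (f x))\<^sup>2 + (norm (g x))\<^sup>2" for x
    using sum_squares_bound[of "norm (f x)" "norm (g x)"] mult_nonneg_nonneg[OF norm_ge_zero[of "f x"] norm_ge_zero[of "g x"]]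
    unfolding norm_mult by linarith
  then show "AE x in lborel. norm (f x * g x) \<le> norm ((norm (f x))\<^sup>2 + (norm (g x))\<^sup>2)"
    by simp
qed

lemma integrable_L2_inner:
  assumes "f \<in> L2" "g \<in> L2"
  shows "integrable lborel (\<lambda>x. f x * cnj (g x))"
  using integrable_L2_mult[OF assms(1) L2_cnj[OF assms(2)]] .

lemma L2_diff:
  assumes "f \<in> L2" "g \<in> L2"
  shows "(\<lambda>x. f x - g x) \<in> L2"
proof -
  have "integrable lborel (\<lambda>x. 2 * ((norm (f x))\<^sup>2 + (norm (g x))\<^sup>2))"
    using assms by (auto simp: L2_def)
  moreover have "norm ((norm (f x - g x))\<^sup>2) \<le> norm (2 * ((norm (f x))\<^sup>2 + (norm (g x))\<^sup>2))" for x
  proof -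
    have "(norm (f x - g x))\<^sup>2 \<le> (norm (f x) + norm (g x))\<^sup>2"
      by (intro power_mono norm_triangle_ineq4) simp
    also have "\<dots> \<le> 2 * ((norm (f x))\<^sup>2 + (norm (g x))\<^sup>2)"
      using sum_squares_bound[of "norm (f x)" "norm (g x)"] by (simp add: power2_sum)
    finally show ?thesis by simp
  qed
  moreover have "(\<lambda>x. (norm (f x - g x))\<^sup>2) \<in> borel_measurable lborel"
    using assms by measurable
  ultimately have "integrable lborel (\<lambda>x. (norm (f x - g x))\<^sup>2)"
    by (metis (no_types, lifting) AE_I2 Bochner_Integration.integrable_bound)
  then show ?thesis
    using assms by (auto simp: L2_def)
qed

lemma L2_translate:
  fixes x :: real
  shows "f \<in> L2 \<Longrightarrow> (\<lambda>t. f (t - x)) \<in> L2"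
proof -
  assume f: "f \<in> L2"
  then have [measurable]: "f \<in> borel_measurable borel"
    by (simp add: L2_def)
  from f have "integrable lborel (\<lambda>t. (norm (f (- x + 1 * t)))\<^sup>2)"
    by (intro lborel_integrable_real_affine[where f = "\<lambda>t. (norm (f t))\<^sup>2"]) (auto simp: L2_def)
  then show ?thesis
    using f by (simp add: L2_def) measurable
qed

lemma rho_L2:
  fixes x :: real
  assumes "f \<in> L2"
  shows "rho (x, \<xi>) \<tau> f \<in> L2"
proof -
  have [measurable]: "cis \<in> borel_measurable borel"
    by (intro borel_measurable_continuous_onI continuous_intros)
  have [measurable]: "(\<lambda>t. f (t - x)) \<in> borel_measurable borel"
    using L2_translate[OF assms, of x] by (simp add: L2_def)
  show ?thesis
    using L2_translate[OF assms, of x] by (simp add: rho_def L2_def norm_mult)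
qed

lemma L2_inner_ae_cong:
  assumes "f \<in> L2" "f' \<in> L2" "g \<in> L2" "g' \<in> L2" "f =\<^sub>a\<^sub>e f'" "g =\<^sub>a\<^sub>e g'"
  shows "L2_inner f g = L2_inner f' g'"
  unfolding L2_inner_def
  by (rule integral_cong_AE) (use assms in \<open>auto simp: ae_eq_def dest: integrable_L2_inner\<close>)

lemma Cauchy_Schwarz_L2:
  assumes "f \<in> L2" "g \<in> L2"
  shows "(norm (LINT x|lborel. f x * g x))\<^sup>2
    \<le> (LINT x|lborel. (norm (f x))\<^sup>2) * (LINT x|lborel. (norm (g x))\<^sup>2)"
proof -
  let ?W = "LINT x|lborel. norm (f x) * norm (g x)"
  let ?V = "LINT x|lborel. (norm (g x))\<^sup>2"
  let ?U = "LINT x|lborel. (norm (f x))\<^sup>2"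
  have i: "integrable lborel (\<lambda>x. (norm (f x))\<^sup>2)" "integrable lborel (\<lambda>x. (norm (g x))\<^sup>2)"
    using assms by (auto simp: L2_def)
  have iw: "integrable lborel (\<lambda>x. norm (f x) * norm (g x))"
    using integrable_norm[OF integrable_L2_mult[OF assms]] by (simp add: norm_mult)
  \<comment> \<open>The bound is the nonnegativity of a quadratic polynomial in \<open>s\<close>,
    the integral of \<open>(s * norm (f x) - norm (g x))\<^sup>2\<close>, evaluated at its minimiser
    \<open>?s\<close>. The minimiser exists only if \<open>?U\<close> is nonzero; otherwise
    \<open>f\<close> vanishes almost everywhere.\<close>
  have W: "?W\<^sup>2 \<le> ?U * ?V"
  proof (cases "?U = 0")
    case True
    then have "AE x in lborel. (norm (f x))\<^sup>2 = 0"
      by (subst (asm) integral_nonneg_eq_0_iff_AE) (use i in auto)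
    then have "?W = (LINT x|(lborel::'a measure). 0)"
      by (intro integral_cong_AE) (use assms in \<open>measurable, auto\<close>)
    then show ?thesis using True by simp
  next
    case False
    have U: "?U \<ge> 0" by simp
    with False have U: "?U > 0" by linarith
    let ?s = "?W / ?U"
    have "0 \<le> (LINT x|lborel. (?s * norm (f x) - norm (g x))\<^sup>2)"
      by simp
    also have "\<dots> = (LINT x|lborel. ?s\<^sup>2 * (norm (f x))\<^sup>2 - 2 * ?s * (norm (f x) * norm (g x)) + (norm (g x))\<^sup>2)"
      by (rule Bochner_Integration.integral_cong) (auto simp: power2_eq_square algebra_simps)
    also have "\<dots> = ?s\<^sup>2 * ?U - 2 * ?s * ?W + ?V"
      using i iw by simp
    also have "\<dots> = ?V - ?W\<^sup>2 / ?U"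
      using U by (simp add: power2_eq_square field_simps)
    finally show ?thesis using U by (simp add: field_simps)
  qed
  have "norm (LINT x|lborel. f x * g x) \<le> ?W"
    using integral_norm_bound[of lborel "\<lambda>x. f x * g x"] by (simp add: norm_mult)
  then have "(norm (LINT x|lborel. f x * g x))\<^sup>2 \<le> ?W\<^sup>2"
    by (intro power_mono) auto
  with W show ?thesis by linarith
qed

text \<open>Writing the distance through inner products alone makes it computable for images under a
  unitary operator, where only those inner products are known.\<close>

lemma integral_norm_diff_L2:
  assumes "f \<in> L2" "g \<in> L2"
  shows "(LINT x|lborel. (norm (f x - g x))\<^sup>2)
    = Re (L2_inner f f) + Re (L2_inner g g) - Re (L2_inner f g) - Re (L2_inner g f)"
proof -
  have "complex_of_real (LINT x|lborel. (norm (f x - g x))\<^sup>2)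
      = (LINT x|lborel. f x * cnj (f x) + g x * cnj (g x) - f x * cnj (g x) - g x * cnj (f x))"
    by (simp add: complex_norm_square algebra_simps flip: integral_complex_of_real del: of_real_power)
  also have "\<dots> = L2_inner f f + L2_inner g g - L2_inner f g - L2_inner g f"
    using assms by (simp add: L2_inner_def integrable_L2_inner)
  finally have "Re (of_real (LINT x|lborel. (norm (f x - g x))\<^sup>2))
      = Re (L2_inner f f + L2_inner g g - L2_inner f g - L2_inner g f)"
    by (rule arg_cong)
  then show ?thesis
    by (simp only: Re_complex_of_real plus_complex.sel minus_complex.sel)
qed

section \<open>Inner products of shifted Gaussians\<close>

lemma L2_inner_gaussian:
  "L2_inner (\<lambda>t. gaussian (x - t)) (\<lambda>t. gaussian (y - t)) = of_real (exp (- pi * (x - y)\<^sup>2 / 2) / sqrt 2)"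
  for x y :: real
proof -
  have "L2_inner (\<lambda>t. gaussian (x - t)) (\<lambda>t. gaussian (y - t))
      = (LINT t|lborel. exp (of_real (2 * pi * (x + y)) * of_real t - of_real (2 * pi * t\<^sup>2)
          + of_real (- pi * (x\<^sup>2 + y\<^sup>2))))"
    unfolding L2_inner_def cnj_gaussian
    by (rule Bochner_Integration.integral_cong)
      (auto simp: gaussian_real mult_exp_exp power2_diff algebra_simps)
  also have "\<dots> = of_real (sqrt (pi / (2 * pi)))
      * exp ((of_real (2 * pi * (x + y)))\<^sup>2 / of_real (4 * (2 * pi)) + of_real (- pi * (x\<^sup>2 + y\<^sup>2)))"
    by (rule integral_exp_quadratic) simp
  also have "(of_real (2 * pi * (x + y)))\<^sup>2 / of_real (4 * (2 * pi)) + of_real (- pi * (x\<^sup>2 + y\<^sup>2))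
      = complex_of_real (- pi * (x - y)\<^sup>2 / 2)"
    by (simp add: field_simps power2_eq_square)
  finally show ?thesis
    by (simp only: exp_of_real) (simp add: real_sqrt_divide)
qed

text \<open>This is the ambiguity function of a Gaussian. The symmetric phase
  \<open>- pi * u * \<eta>\<close> in \<open>rho\<close> cancels the mixed term from completing the
  square, so the centre \<open>y\<close> enters only through a phase.\<close>

lemma L2_inner_rho_gaussian:
  "L2_inner (rho (u, \<eta>) 0 (\<lambda>t. gaussian (y - t))) (\<lambda>t. gaussian (y - t))
     = exp (of_real (2 * pi * \<eta> * y) * \<i> - of_real (pi / 2 * (u\<^sup>2 + \<eta>\<^sup>2))) / of_real (sqrt 2)"
  for y u \<eta> :: real
proof -
  have "L2_inner (rho (u, \<eta>) 0 (\<lambda>t. gaussian (y - t))) (\<lambda>t. gaussian (y - t))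
      = (LINT t|lborel. exp ((of_real (2 * pi * (2 * y + u)) + of_real (2 * pi * \<eta>) * \<i>) * of_real t
          - of_real (2 * pi * t\<^sup>2) + (of_real (- pi * ((y + u)\<^sup>2 + y\<^sup>2)) - of_real (pi * u * \<eta>) * \<i>)))"
    unfolding L2_inner_def cnj_gaussian
    by (rule Bochner_Integration.integral_cong)
      (auto simp: rho_def gaussian_real mult_exp_exp cis_conv_exp power2_eq_square algebra_simps)
  also have "\<dots> = of_real (sqrt (pi / (2 * pi)))
      * exp ((of_real (2 * pi * (2 * y + u)) + of_real (2 * pi * \<eta>) * \<i>)\<^sup>2 / of_real (4 * (2 * pi))
          + (of_real (- pi * ((y + u)\<^sup>2 + y\<^sup>2)) - of_real (pi * u * \<eta>) * \<i>))"
    by (rule integral_exp_quadratic) simp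
  also have "(of_real (2 * pi * (2 * y + u)) + of_real (2 * pi * \<eta>) * \<i>)\<^sup>2 / of_real (4 * (2 * pi))
          + (of_real (- pi * ((y + u)\<^sup>2 + y\<^sup>2)) - of_real (pi * u * \<eta>) * \<i>)
      = of_real (2 * pi * \<eta> * y) * \<i> - of_real (pi / 2 * (u\<^sup>2 + \<eta>\<^sup>2))"
    by (simp add: field_simps power2_eq_square)
  finally show ?thesis
    by (simp add: real_sqrt_divide)
qed

section \<open>The modulus of the smoothed kernel\<close>

lemma integrable_translate_mult_L2:
  fixes F :: "real \<Rightarrow> complex"
  assumes "F \<in> L2"
  shows "integrable lborel (\<lambda>t. F (t - p) * cnj (F t))"
  by (rule integrable_L2_inner[OF L2_translate[OF assms] assms])

text \<open>Moyal's identity \<open>\<integral>\<integral> \<langle>\<rho>(z)F, F\<rangle> \<langle>G, \<rho>(z)G\<rangle> dz = |\<langle>F, G\<rangle>|\<^sup>2\<close> for a translated Gaussian \<open>G\<close>: carrying out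
  the \<open>\<xi>\<close>-integral first produces exactly the product \<open>G (t - p) * G t\<close>, so no Plancherel theorem is
  needed.\<close>

lemma Moyal_gaussian:
  fixes F :: "real \<Rightarrow> complex" and x :: real
  assumes F: "F \<in> L2"
  shows "of_real ((norm (LINT t|lborel. F t * gaussian (x - t)))\<^sup>2)
    = (LINT p|lborel. LINT \<xi>|lborel. L2_inner (rho (p, \<xi>) 0 F) F
        * exp (- of_real (pi / 2 * (p\<^sup>2 + \<xi>\<^sup>2)) - of_real (2 * pi * x * \<xi>) * \<i>)) / of_real (sqrt 2)"
proof -
  have F_meas [measurable]: "F \<in> borel_measurable borel"
    using F by (simp add: L2_def)
  define K where "K = (\<lambda>t. F t * gaussian (x - t))"
  have K: "integrable lborel K"
    unfolding K_def by (rule integrable_L2_mult[OF F gaussian_at_L2])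
  have K_meas [measurable]: "K \<in> borel_measurable borel"
    unfolding K_def by measurable
  \<comment> \<open>\<open>E p t \<xi>\<close> is the weight in the claim times the phase by which
    \<open>rho (p, \<xi>) 0\<close> multiplies at \<open>t\<close>.\<close>
  define E where "E = (\<lambda>p t \<xi>. exp ((of_real (2 * pi * (t - x - p / 2)) * \<i>) * of_real \<xi>
      - of_real (pi / 2 * \<xi>\<^sup>2) + of_real (- pi / 2 * p\<^sup>2)))"
  \<comment> \<open>The exponents agree by the parallelogram law around the midpoint
    \<open>t - p / 2\<close> of \<open>t - p\<close> and \<open>t\<close>.\<close>
  have E_int: "(LINT \<xi>|lborel. E p t \<xi>) = of_real (sqrt 2) * (gaussian (x - (t - p)) * gaussian (x - t))" for p t
  proof -
    have "(LINT \<xi>|lborel. E p t \<xi>) = of_real (sqrt (pi / (pi / 2)))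
       * exp ((of_real (2 * pi * (t - x - p / 2)) * \<i>)\<^sup>2 / of_real (4 * (pi / 2)) + of_real (- pi / 2 * p\<^sup>2))"
      unfolding E_def by (rule integral_exp_quadratic) simp
    also have "(of_real (2 * pi * (t - x - p / 2)) * \<i>)\<^sup>2 / of_real (4 * (pi / 2)) + of_real (- pi / 2 * p\<^sup>2)
        = complex_of_real (- (pi * (x - (t - p))\<^sup>2) - pi * (x - t)\<^sup>2)"
      by (simp add: complex_eq_iff Re_power2 Im_power2 power2_eq_square field_simps)
    finally show ?thesis
      by (simp add: gaussian_real mult_exp_exp)
  qed
  \<comment> \<open>For fixed \<open>t\<close> the substitution \<open>s = t - p\<close> turns the
    inner integral of the modulus into the \<open>L\<^sup>1\<close> norm of \<open>K\<close> times
    \<open>norm (K t)\<close>.\<close>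
  have int1: "integrable (lborel \<Otimes>\<^sub>M lborel) (\<lambda>(t, p). K (t - p) * cnj (K t))"
  proof (rule lborel_pair.Fubini_integrable)
    have "(LINT p|lborel. norm (K (t - p) * cnj (K t))) = (LINT s|lborel. norm (K s)) * norm (K t)" for t
      using lborel_integral_real_affine[of "-1" "\<lambda>s. norm (K s)" t]
      by (simp add: norm_mult)
    then show "integrable lborel (\<lambda>t. LINT p|lborel. norm (case (t, p) of (t, p) \<Rightarrow> K (t - p) * cnj (K t)))"
      using K by simp
    have "integrable lborel (\<lambda>p. K (t - p))" for t
      using lborel_integrable_real_affine[OF K, of "-1" t] by simp
    then show "AE t in lborel. integrable lborel (\<lambda>p. case (t, p) of (t, p) \<Rightarrow> K (t - p) * cnj (K t))"
      by simp
  qed measurable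
  have int2: "integrable (lborel \<Otimes>\<^sub>M lborel) (\<lambda>(t, \<xi>). F (t - p) * cnj (F t) * E p t \<xi>)" for p
  proof (rule lborel_pair.Fubini_integrable)
    \<comment> \<open>The variable \<open>t\<close> enters \<open>E\<close> only through a phase, so
      the modulus of the integrand is a product of a function of \<open>t\<close> and a function of
      \<open>\<xi>\<close>.\<close>
    define N where "N = (\<lambda>\<xi>. norm (E p 0 \<xi>))"
    have nE: "norm (E p t \<xi>) = N \<xi>" for t \<xi>
      by (simp add: E_def N_def)
    have "integrable lborel (\<lambda>t. norm (F (t - p) * cnj (F t)) * (LINT \<xi>|lborel. N \<xi>))"
      by (intro integrable_mult_left integrable_norm integrable_translate_mult_L2 F)
    then show "integrable lborel (\<lambda>t. LINT \<xi>|lborel.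
          norm (case (t, \<xi>) of (t, \<xi>) \<Rightarrow> F (t - p) * cnj (F t) * E p t \<xi>))"
      by (simp add: norm_mult nE)
    have "integrable lborel (E p t)" for t
      unfolding E_def by (intro integrable_exp_quadratic) simp
    then show "AE t in lborel. integrable lborel (\<lambda>\<xi>. case (t, \<xi>) of (t, \<xi>) \<Rightarrow> F (t - p) * cnj (F t) * E p t \<xi>)"
      by simp
    show "(\<lambda>(t, \<xi>). F (t - p) * cnj (F t) * E p t \<xi>) \<in> borel_measurable (lborel \<Otimes>\<^sub>M lborel)"
      unfolding E_def by measurable
  qed
  have inner: "(LINT t|lborel. K (t - p) * cnj (K t)) = (LINT \<xi>|lborel. L2_inner (rho (p, \<xi>) 0 F) F
        * exp (- of_real (pi / 2 * (p\<^sup>2 + \<xi>\<^sup>2)) - of_real (2 * pi * x * \<xi>) * \<i>)) / of_real (sqrt 2)" for p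
  proof -
    have "(LINT t|lborel. K (t - p) * cnj (K t))
        = (LINT t|lborel. (LINT \<xi>|lborel. F (t - p) * cnj (F t) * E p t \<xi>) / of_real (sqrt 2))"
      by (rule Bochner_Integration.integral_cong) (simp_all add: E_int K_def)
    also have "\<dots> = (LINT \<xi>|lborel. LINT t|lborel. F (t - p) * cnj (F t) * E p t \<xi>) / of_real (sqrt 2)"
      using lborel_pair.Fubini_integral[OF int2[of p]] by simp
    also have "(LINT \<xi>|lborel. LINT t|lborel. F (t - p) * cnj (F t) * E p t \<xi>)
        = (LINT \<xi>|lborel. L2_inner (rho (p, \<xi>) 0 F) F
            * exp (- of_real (pi / 2 * (p\<^sup>2 + \<xi>\<^sup>2)) - of_real (2 * pi * x * \<xi>) * \<i>))"
    proof (rule Bochner_Integration.integral_cong)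
      fix \<xi> :: real
      have "E p t \<xi> = cis (- pi * (p * \<xi>)) * cis (2 * pi * (\<xi> * t))
          * exp (- of_real (pi / 2 * (p\<^sup>2 + \<xi>\<^sup>2)) - of_real (2 * pi * x * \<xi>) * \<i>)" for t
        unfolding E_def cis_conv_exp mult_exp_exp
        by (rule arg_cong[of _ _ exp]) (simp add: complex_eq_iff Re_power2 Im_power2 power2_eq_square field_simps)
      then have "F (t - p) * cnj (F t) * E p t \<xi> = rho (p, \<xi>) 0 F t * cnj (F t)
          * exp (- of_real (pi / 2 * (p\<^sup>2 + \<xi>\<^sup>2)) - of_real (2 * pi * x * \<xi>) * \<i>)" for t
        by (simp add: rho_def)
      then show "(LINT t|lborel. F (t - p) * cnj (F t) * E p t \<xi>) = L2_inner (rho (p, \<xi>) 0 F) F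
          * exp (- of_real (pi / 2 * (p\<^sup>2 + \<xi>\<^sup>2)) - of_real (2 * pi * x * \<xi>) * \<i>)"
        by (simp only: L2_inner_def integral_mult_left_zero)
    qed simp
    finally show ?thesis .
  qed
  have "of_real ((norm (LINT t|lborel. K t))\<^sup>2) = (LINT s|lborel. K s) * cnj (LINT t|lborel. K t)"
    by (rule complex_norm_square)
  also have "\<dots> = (LINT t|lborel. (LINT s|lborel. K s) * cnj (K t))"
    by simp
  \<comment> \<open>Substituting \<open>s = t - p\<close> exhibits the squared modulus as the
    integral over \<open>p\<close> of the autocorrelation of \<open>K\<close>, which
    \<open>inner\<close> rewrites.\<close>
  also have "\<dots> = (LINT t|lborel. LINT p|lborel. K (t - p) * cnj (K t))"
    using lborel_integral_real_affine[of "-1" K] by simp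
  also have "\<dots> = (LINT p|lborel. LINT t|lborel. K (t - p) * cnj (K t))"
    using lborel_pair.Fubini_integral[OF int1] by simp
  finally show ?thesis
    unfolding inner integral_divide_zero unfolding K_def .
qed

section \<open>Covariance of metaplectic operators\<close>

lemma metaplectic_unitary: "metaplectic S U \<Longrightarrow> unitary_on_L2 U"
  by (simp add: metaplectic_def)

lemma unitary_on_L2_mem: "unitary_on_L2 U \<Longrightarrow> f \<in> L2 \<Longrightarrow> U f \<in> L2"
  by (simp add: unitary_on_L2_def)

lemma unitary_on_L2_inner: "unitary_on_L2 U \<Longrightarrow> f \<in> L2 \<Longrightarrow> g \<in> L2 \<Longrightarrow> L2_inner (U f) (U g) = L2_inner f g"
  by (simp add: unitary_on_L2_def)

lemma ae_eq_refl: "f =\<^sub>a\<^sub>e f"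
  by (simp add: ae_eq_def)

text \<open>The intertwining relation with \<open>g = U f\<close> moves \<open>rho\<close> through
  \<open>U\<close>, and unitarity then removes \<open>U\<close>. The relation holds only almost
  everywhere, which the inner product does not see.\<close>

lemma L2_inner_rho_metaplectic:
  fixes S :: "real \<times> real \<Rightarrow> real \<times> real"
  assumes U: "metaplectic S U" and f: "f \<in> L2"
  shows "L2_inner (rho (S z) 0 (U f)) (U f) = L2_inner (rho z 0 f) f"
proof -
  note unitary = metaplectic_unitary[OF U]
  have Uf: "U f \<in> L2"
    by (rule unitary_on_L2_mem[OF unitary f])
  have rho_f: "rho z 0 f \<in> L2"
    by (cases z) (simp add: rho_L2 f)
  have rho_Uf: "rho (S z) 0 (U f) \<in> L2"
    by (cases "S z") (simp add: rho_L2 Uf)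
  have "U (rho z 0 f) =\<^sub>a\<^sub>e rho (S z) 0 (U f)"
    using U f Uf ae_eq_refl unfolding metaplectic_def by blast
  then have "L2_inner (U (rho z 0 f)) (U f) = L2_inner (rho (S z) 0 (U f)) (U f)"
    by (intro L2_inner_ae_cong unitary_on_L2_mem[OF unitary] rho_f rho_Uf Uf f ae_eq_refl)
  then show ?thesis
    using unitary_on_L2_inner[OF unitary rho_f f] by simp
qed

text \<open>The numbers \<open>1 + C\<^sup>2 + D\<^sup>2\<close>, \<open>- b\<close> and \<open>e\<close> are the entries of the Gram matrix of the quadratic form
  \<open>|z|\<^sup>2 + |S\<^sup>-\<^sup>1 z|\<^sup>2\<close>, and \<open>\<delta>\<close> is its determinant divided by \<open>e\<close>.\<close>

lemma norm_metaplectic_gaussian: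
  fixes A B C D x y :: real
  defines "b \<equiv> B * D + A * C" and "e \<equiv> 1 + A\<^sup>2 + B\<^sup>2"
  defines "\<delta> \<equiv> 1 + C\<^sup>2 + D\<^sup>2 - b\<^sup>2 / e"
  assumes det: "A * D - B * C = 1" and U: "metaplectic (matrix_map A B C D) U"
  shows "\<delta> > 0"
    and "(norm (LINT t|lborel. U (\<lambda>s. gaussian (y - s)) t * gaussian (x - t)))\<^sup>2
      = exp (- (2 * pi / e * (A * y - x)\<^sup>2) - 2 * pi / \<delta> * (b / e * (A * y - x) - C * y)\<^sup>2) / sqrt (e * \<delta>)"
proof -
  have e: "e > 0"
    unfolding e_def using zero_le_power2[of A] zero_le_power2[of B] by linarith
  \<comment> \<open>Lagrange's identity for the rows \<open>(A, B)\<close> and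
    \<open>(C, D)\<close>: the product of their squared norms minus \<open>b\<^sup>2\<close> is the
    squared determinant.\<close>
  have "(1 + C\<^sup>2 + D\<^sup>2) * e - b\<^sup>2 = 1 + A\<^sup>2 + B\<^sup>2 + C\<^sup>2 + D\<^sup>2 + (A * D - B * C)\<^sup>2"
    by (simp add: e_def b_def power2_eq_square algebra_simps)
  then have "(1 + C\<^sup>2 + D\<^sup>2) * e - b\<^sup>2 > 0"
    unfolding det by (simp add: add_pos_nonneg)
  then show \<delta>: "\<delta> > 0"
    using e by (simp add: \<delta>_def field_simps)
  define F where "F = U (\<lambda>s. gaussian (y - s))"
  have F: "F \<in> L2"
    unfolding F_def by (rule unitary_on_L2_mem[OF metaplectic_unitary[OF U] gaussian_at_L2])
  define X where "X = A * y - x"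
  define Z where "Z = b / e * X - C * y"
  \<comment> \<open>The exponent of the phase-space integrand is sorted by powers of
    \<open>\<xi>\<close>: \<open>?\<beta> p\<close> is the linear coefficient and
    \<open>?\<gamma> p\<close> the part free of \<open>\<xi>\<close>.\<close>
  let ?\<beta> = "\<lambda>p. of_real (pi * b * p) + of_real (2 * pi * X) * \<i>"
  let ?\<gamma> = "\<lambda>p. - of_real (pi / 2 * (1 + C\<^sup>2 + D\<^sup>2) * p\<^sup>2) - of_real (2 * pi * C * y * p) * \<i>"
  have integrand: "L2_inner (rho (p, \<xi>) 0 F) F * exp (- of_real (pi / 2 * (p\<^sup>2 + \<xi>\<^sup>2)) - of_real (2 * pi * x * \<xi>) * \<i>)
      = exp (?\<beta> p * of_real \<xi> - of_real (pi * e / 2 * \<xi>\<^sup>2) + ?\<gamma> p) / of_real (sqrt 2)" for p \<xi>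
  proof -
    \<comment> \<open>The preimage of \<open>(p, \<xi>)\<close> is read off from the adjugate
      matrix, which is the inverse since the determinant is 1.\<close>
    have z: "matrix_map A B C D (D * p - B * \<xi>, A * \<xi> - C * p) = (p, \<xi>)"
    proof -
      have "A * (D * p - B * \<xi>) + B * (A * \<xi> - C * p) = (A * D - B * C) * p"
        "C * (D * p - B * \<xi>) + D * (A * \<xi> - C * p) = (A * D - B * C) * \<xi>"
        by (simp_all add: algebra_simps)
      then show ?thesis
        by (simp add: matrix_map_def det)
    qed
    have "L2_inner (rho (p, \<xi>) 0 F) F
        = exp (of_real (2 * pi * (A * \<xi> - C * p) * y) * \<i>
            - of_real (pi / 2 * ((D * p - B * \<xi>)\<^sup>2 + (A * \<xi> - C * p)\<^sup>2))) / of_real (sqrt 2)"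
      using L2_inner_rho_metaplectic[OF U gaussian_at_L2, of "(D * p - B * \<xi>, A * \<xi> - C * p)" y]
      unfolding z L2_inner_rho_gaussian F_def .
    moreover have "(of_real (2 * pi * (A * \<xi> - C * p) * y) * \<i>
            - of_real (pi / 2 * ((D * p - B * \<xi>)\<^sup>2 + (A * \<xi> - C * p)\<^sup>2)))
          + (- of_real (pi / 2 * (p\<^sup>2 + \<xi>\<^sup>2)) - of_real (2 * pi * x * \<xi>) * \<i>)
        = ?\<beta> p * of_real \<xi> - of_real (pi * e / 2 * \<xi>\<^sup>2) + ?\<gamma> p"
      by (simp add: complex_eq_iff Re_power2 Im_power2 X_def e_def b_def power2_eq_square field_simps)
    ultimately show ?thesis
      by (simp only: mult_exp_exp times_divide_eq_left)
  qed
  \<comment> \<open>Integrating out \<open>\<xi>\<close> replaces the coefficient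
    \<open>1 + C\<^sup>2 + D\<^sup>2\<close> by its Schur complement \<open>\<delta>\<close> and
    leaves \<open>Z\<close> as the frequency in \<open>p\<close>.\<close>
  have inner: "(LINT \<xi>|lborel. exp (?\<beta> p * of_real \<xi> - of_real (pi * e / 2 * \<xi>\<^sup>2) + ?\<gamma> p))
      = of_real (sqrt (2 / e)) * exp ((of_real (2 * pi * Z) * \<i>) * of_real p
          - of_real (pi * \<delta> / 2 * p\<^sup>2) + of_real (- (2 * pi / e * X\<^sup>2)))" for p
  proof -
    have "(LINT \<xi>|lborel. exp (?\<beta> p * of_real \<xi> - of_real (pi * e / 2 * \<xi>\<^sup>2) + ?\<gamma> p))
        = of_real (sqrt (pi / (pi * e / 2))) * exp ((?\<beta> p)\<^sup>2 / of_real (4 * (pi * e / 2)) + ?\<gamma> p)"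
      by (rule integral_exp_quadratic) (simp add: e)
    also have "pi / (pi * e / 2) = 2 / e"
      by simp
    also have "(?\<beta> p)\<^sup>2 / of_real (4 * (pi * e / 2)) + ?\<gamma> p
        = (of_real (2 * pi * Z) * \<i>) * of_real p
          - of_real (pi * \<delta> / 2 * p\<^sup>2) + of_real (- (2 * pi / e * X\<^sup>2))"
    proof -
      have "(?\<beta> p)\<^sup>2 = of_real ((pi * b * p)\<^sup>2 - (2 * pi * X)\<^sup>2) + of_real (2 * (pi * b * p) * (2 * pi * X)) * \<i>"
        by (simp add: power2_sum power_mult_distrib algebra_simps)
      then have "(?\<beta> p)\<^sup>2 / of_real (4 * (pi * e / 2)) =
          of_real (((pi * b * p)\<^sup>2 - (2 * pi * X)\<^sup>2) / (4 * (pi * e / 2)))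
          + of_real (2 * (pi * b * p) * (2 * pi * X) / (4 * (pi * e / 2))) * \<i>"
        by (simp add: add_divide_distrib)
      moreover have "((pi * b * p)\<^sup>2 - (2 * pi * X)\<^sup>2) / (4 * (pi * e / 2))
          = pi / 2 * (1 + C\<^sup>2 + D\<^sup>2) * p\<^sup>2 - pi * \<delta> / 2 * p\<^sup>2 - 2 * pi / e * X\<^sup>2"
        using e by (simp add: \<delta>_def power2_eq_square field_simps)
      moreover have "2 * (pi * b * p) * (2 * pi * X) / (4 * (pi * e / 2)) = 2 * pi * Z * p + 2 * pi * C * y * p"
        using e by (simp add: Z_def field_simps)
      ultimately show ?thesis
        by (simp only:) (simp add: algebra_simps)
    qed
    finally show ?thesis .
  qed
  have outer: "(LINT p|lborel. exp ((of_real (2 * pi * Z) * \<i>) * of_real p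
        - of_real (pi * \<delta> / 2 * p\<^sup>2) + of_real (- (2 * pi / e * X\<^sup>2))))
      = complex_of_real (sqrt (2 / \<delta>) * exp (- (2 * pi / e * X\<^sup>2) - 2 * pi / \<delta> * Z\<^sup>2))"
  proof -
    have "(LINT p|lborel. exp ((of_real (2 * pi * Z) * \<i>) * of_real p
        - of_real (pi * \<delta> / 2 * p\<^sup>2) + of_real (- (2 * pi / e * X\<^sup>2))))
      = of_real (sqrt (pi / (pi * \<delta> / 2))) * exp ((of_real (2 * pi * Z) * \<i>)\<^sup>2 / of_real (4 * (pi * \<delta> / 2))
          + of_real (- (2 * pi / e * X\<^sup>2)))"
      by (rule integral_exp_quadratic) (simp add: \<delta>)
    also have "pi / (pi * \<delta> / 2) = 2 / \<delta>"
      by simp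
    also have "(of_real (2 * pi * Z) * \<i>)\<^sup>2 / of_real (4 * (pi * \<delta> / 2)) + of_real (- (2 * pi / e * X\<^sup>2))
        = complex_of_real (- (2 * pi / e * X\<^sup>2) - 2 * pi / \<delta> * Z\<^sup>2)"
      using e \<delta> by (simp add: power_mult_distrib power2_eq_square field_simps)
    finally show ?thesis
      by (simp only: exp_of_real of_real_mult)
  qed
  \<comment> \<open>One factor \<open>sqrt 2\<close> in the denominator comes from the ambiguity
    function, the other from Moyal's identity.\<close>
  have "complex_of_real ((norm (LINT t|lborel. F t * gaussian (x - t)))\<^sup>2)
      = of_real (sqrt (2 / e) * (sqrt (2 / \<delta>) * exp (- (2 * pi / e * X\<^sup>2) - 2 * pi / \<delta> * Z\<^sup>2)) / sqrt 2 / sqrt 2)"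
    unfolding Moyal_gaussian[OF F] integrand integral_divide_zero inner integral_mult_right_zero outer
    by (simp only: of_real_mult of_real_divide)
  also have "sqrt (2 / e) * (sqrt (2 / \<delta>) * exp (- (2 * pi / e * X\<^sup>2) - 2 * pi / \<delta> * Z\<^sup>2)) / sqrt 2 / sqrt 2
      = exp (- (2 * pi / e * X\<^sup>2) - 2 * pi / \<delta> * Z\<^sup>2) / sqrt (e * \<delta>)"
    by (simp add: real_sqrt_divide real_sqrt_mult)
  finally show "(norm (LINT t|lborel. U (\<lambda>s. gaussian (y - s)) t * gaussian (x - t)))\<^sup>2
      = exp (- (2 * pi / e * (A * y - x)\<^sup>2) - 2 * pi / \<delta> * (b / e * (A * y - x) - C * y)\<^sup>2) / sqrt (e * \<delta>)"
    by (simp only: of_real_eq_iff X_def Z_def F_def)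
qed

section \<open>Gaussians as test functions\<close>

text \<open>The form polynomial times Gaussian is stable under differentiation, by the product rule,
  and \<open>Basis\<close> on the reals contains only 1.\<close>

lemma partials_gaussian:
  fixes x :: real
  assumes "set vs \<subseteq> Basis"
  shows "\<exists>p :: real poly. partials vs (\<lambda>t. gaussian (x - t))
    = (\<lambda>t. of_real (poly p t * exp (- (pi * (x - t)\<^sup>2))))"
  using assms
proof (induction vs)
  case Nil
  have "partials [] (\<lambda>t. gaussian (x - t)) = (\<lambda>t. of_real (poly 1 t * exp (- (pi * (x - t)\<^sup>2))))"
    by (simp add: gaussian_def)
  then show ?case ..
next
  case (Cons v vs)
  then have v: "v = 1" by simp
  from Cons obtain p :: "real poly" where p: "partials vs (\<lambda>t. gaussian (x - t))
      = (\<lambda>t. of_real (poly p t * exp (- (pi * (x - t)\<^sup>2))))"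
    by auto
  \<comment> \<open>The second factor is \<open>2 * pi * (x - t)\<close>, the derivative of the
    exponent.\<close>
  define q where "q = pderiv p + p * [:2 * pi * x, - 2 * pi:]"
  have "((\<lambda>t. complex_of_real (poly p t * exp (- (pi * (x - t)\<^sup>2)))) has_vector_derivative
      of_real (poly q t * exp (- (pi * (x - t)\<^sup>2)))) (at t)" for t
    by (rule has_vector_derivative_of_real)
      (auto intro!: derivative_eq_intros simp: q_def algebra_simps)
  then have "frechet_derivative (\<lambda>t. complex_of_real (poly p t * exp (- (pi * (x - t)\<^sup>2)))) (at t)
      = (\<lambda>h. h *\<^sub>R of_real (poly q t * exp (- (pi * (x - t)\<^sup>2))))" for t
    unfolding has_vector_derivative_def by (rule frechet_derivative_at[symmetric])
  then have "partials (v # vs) (\<lambda>t. gaussian (x - t)) = (\<lambda>t. of_real (poly q t * exp (- (pi * (x - t)\<^sup>2))))"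
    by (simp only: partials.simps p v) simp
  then show ?case ..
qed

text \<open>An exponential bound is crude but passes through a Horner step, and a Gaussian still
  dominates it.\<close>

lemma abs_poly_le_exp: "\<exists>K n. \<forall>t. \<bar>poly p t\<bar> \<le> K * exp (real n * \<bar>t\<bar>)" for p :: "real poly"
proof (induction p)
  case 0
  then show ?case by (auto intro: exI[of _ 0])
next
  case (pCons a p)
  then obtain K n where K: "\<And>t. \<bar>poly p t\<bar> \<le> K * exp (real n * \<bar>t\<bar>)"
    by blast
  have "\<bar>poly (pCons a p) t\<bar> \<le> (\<bar>a\<bar> + K) * exp (real (Suc n) * \<bar>t\<bar>)" for t
  proof -
    have "\<bar>poly (pCons a p) t\<bar> \<le> \<bar>a\<bar> + \<bar>t\<bar> * \<bar>poly p t\<bar>"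
      using abs_triangle_ineq[of a "t * poly p t"] by (simp add: abs_mult)
    also have "\<dots> \<le> \<bar>a\<bar> * exp (real (Suc n) * \<bar>t\<bar>) + exp \<bar>t\<bar> * (K * exp (real n * \<bar>t\<bar>))"
    proof (intro add_mono mult_mono K)
      show "\<bar>a\<bar> \<le> \<bar>a\<bar> * exp (real (Suc n) * \<bar>t\<bar>)"
        using mult_left_mono[of 1 "exp (real (Suc n) * \<bar>t\<bar>)" "\<bar>a\<bar>"] by simp
      show "\<bar>t\<bar> \<le> exp \<bar>t\<bar>"
        using exp_ge_add_one_self[of "\<bar>t\<bar>"] by linarith
    qed auto
    also have "\<dots> = (\<bar>a\<bar> + K) * exp (real (Suc n) * \<bar>t\<bar>)"
      by (simp add: algebra_simps exp_add)
    finally show ?thesis .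
  qed
  then show ?case by blast
qed

lemma japanese_real_sq: "(japanese x)\<^sup>2 = 1 + x\<^sup>2" for x :: real
  by (simp add: japanese_def)

lemma japanese_pos: "japanese x > 0"
  by (simp add: japanese_def add_pos_nonneg)

lemma japanese_real_le_exp: "japanese t \<le> exp \<bar>t\<bar>" for t :: real
proof -
  have "japanese t \<le> 1 + \<bar>t\<bar>"
    by (rule power2_le_imp_le) (simp_all add: japanese_real_sq power2_sum)
  also have "\<dots> \<le> exp \<bar>t\<bar>"
    by (rule exp_ge_add_one_self)
  finally show ?thesis .
qed

lemma gaussian_at_schwartz: "(\<lambda>t. gaussian (x - t)) \<in> schwartz" for x :: real
proof -
  have "partials vs (\<lambda>t. gaussian (x - t)) differentiable at t"
    and "bounded (range (\<lambda>t. japanese t ^ m * norm (partials vs (\<lambda>t. gaussian (x - t)) t)))"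
    if vs: "set vs \<subseteq> Basis" for vs m t
  proof -
    obtain p :: "real poly" where p: "partials vs (\<lambda>t. gaussian (x - t))
        = (\<lambda>t. of_real (poly p t * exp (- (pi * (x - t)\<^sup>2))))"
      using partials_gaussian[OF vs] by blast
    have "((\<lambda>t. complex_of_real (poly p t * exp (- (pi * (x - t)\<^sup>2)))) has_vector_derivative
        of_real (poly (pderiv p + p * [:2 * pi * x, - 2 * pi:]) t * exp (- (pi * (x - t)\<^sup>2)))) (at t)"
      by (rule has_vector_derivative_of_real)
        (auto intro!: derivative_eq_intros simp: algebra_simps)
    then show "partials vs (\<lambda>t. gaussian (x - t)) differentiable at t"
      unfolding p has_vector_derivative_def by (rule differentiableI)
    obtain K n where K: "\<And>t. \<bar>poly p t\<bar> \<le> K * exp (real n * \<bar>t\<bar>)"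
      using abs_poly_le_exp by blast
    have "norm (japanese t ^ m * norm (partials vs (\<lambda>t. gaussian (x - t)) t))
        \<le> K * exp (real (m + n) * \<bar>x\<bar> + (real (m + n))\<^sup>2)" for t
    proof -
      have K0: "K \<ge> 0" using K[of 0] by simp
      define r where "r = real (m + n)"
      define s where "s = \<bar>x - t\<bar>"
      have "norm (japanese t ^ m * norm (partials vs (\<lambda>t. gaussian (x - t)) t))
          = japanese t ^ m * (\<bar>poly p t\<bar> * exp (- (pi * (x - t)\<^sup>2)))"
        using japanese_pos[of t] by (simp add: p norm_mult)
      also have "\<dots> \<le> exp \<bar>t\<bar> ^ m * (K * exp (real n * \<bar>t\<bar>) * exp (- (pi * (x - t)\<^sup>2)))"
        using K0 by (intro mult_mono power_mono K japanese_real_le_exp) (auto simp: japanese_pos less_imp_le)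
      also have "\<dots> = K * exp (r * \<bar>t\<bar> - pi * s\<^sup>2)"
        by (simp add: exp_of_nat_mult[symmetric] mult_exp_exp r_def s_def algebra_simps)
      also have "\<dots> \<le> K * exp (r * \<bar>x\<bar> + r\<^sup>2)"
      proof -
        \<comment> \<open>Since \<open>\<bar>t\<bar> \<le> \<bar>x\<bar> + s\<close>, it remains to
          absorb \<open>r * s\<close>, which is at most \<open>r\<^sup>2 + s\<^sup>2\<close>; the
          term \<open>s\<^sup>2\<close> is then beaten by \<open>pi * s\<^sup>2\<close>.\<close>
        have r0: "r \<ge> 0" and s0: "s \<ge> 0" by (auto simp: r_def s_def)
        have "r * \<bar>t\<bar> \<le> r * (\<bar>x\<bar> + s)"
          using r0 by (intro mult_left_mono) (auto simp: s_def)
        moreover have "2 * (r * s) \<le> r\<^sup>2 + s\<^sup>2"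
          using sum_squares_bound[of r s] by simp
        moreover have "1 * s\<^sup>2 \<le> pi * s\<^sup>2"
          using pi_gt3 by (intro mult_right_mono) auto
        moreover have "0 \<le> r * s"
          using r0 s0 by simp
        ultimately have "r * \<bar>t\<bar> - pi * s\<^sup>2 \<le> r * \<bar>x\<bar> + r\<^sup>2"
          by (simp add: algebra_simps)
        then show ?thesis
          using K0 by (intro mult_left_mono) auto
      qed
      finally show ?thesis unfolding r_def .
    qed
    then show "bounded (range (\<lambda>t. japanese t ^ m * norm (partials vs (\<lambda>t. gaussian (x - t)) t)))"
      unfolding bounded_iff by blast
  qed
  then show ?thesis
    unfolding schwartz_def by blast
qed

section \<open>Decay and continuity of the smoothed kernel\<close>

lemma gaussian_bound_imp_diagonal_bound:
  fixes h :: "real \<times> real \<Rightarrow> complex"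
  assumes pos: "c > 0" "\<kappa> > 0" and N: "N > 0"
    and h: "\<And>x y. (norm (h (x, y)))\<^sup>2 \<le> c * exp (- (\<kappa> * (x - y)\<^sup>2))"
  shows "\<exists>K>0. \<forall>x y. norm (h (x, y)) \<le> K * japanese (x - y) powi (- int N)"
proof (intro exI conjI allI)
  let ?K = "sqrt (c * exp \<kappa> / (\<kappa> / real N) ^ N)"
  show "?K > 0"
    using pos N by simp
  fix x y :: real
  let ?j = "japanese (x - y)"
  \<comment> \<open>The inequality \<open>u \<le> exp u\<close>, raised to the power
    \<open>N\<close>, bounds \<open>?j ^ (2 * N)\<close> by an exponential. As
    \<open>?j\<^sup>2 = 1 + (x - y)\<^sup>2\<close>, that exponential is the inverse of the Gaussian
    decay up to the factor \<open>exp \<kappa>\<close> seen in \<open>?K\<close>.\<close>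
  have "\<kappa> / real N * ?j\<^sup>2 \<le> exp (\<kappa> / real N * ?j\<^sup>2)"
    using exp_ge_add_one_self[of "\<kappa> / real N * ?j\<^sup>2"] by linarith
  then have "(\<kappa> / real N * ?j\<^sup>2) ^ N \<le> exp (\<kappa> / real N * ?j\<^sup>2) ^ N"
    using pos by (intro power_mono) auto
  also have "\<dots> = exp \<kappa> * exp (\<kappa> * (x - y)\<^sup>2)"
    using N by (simp add: exp_of_nat_mult[symmetric] japanese_real_sq exp_add[symmetric] algebra_simps)
  finally have "(\<kappa> / real N * ?j\<^sup>2) ^ N * exp (- (\<kappa> * (x - y)\<^sup>2))
      \<le> exp \<kappa> * exp (\<kappa> * (x - y)\<^sup>2) * exp (- (\<kappa> * (x - y)\<^sup>2))"
    by (rule mult_right_mono) simp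
  moreover have "(\<kappa> / real N * ?j\<^sup>2) ^ N = (\<kappa> / real N) ^ N * (?j ^ N)\<^sup>2"
    unfolding power_mult_distrib by (simp add: mult.commute flip: power_mult)
  ultimately have "(\<kappa> / real N) ^ N * (?j ^ N)\<^sup>2 * exp (- (\<kappa> * (x - y)\<^sup>2)) \<le> exp \<kappa>"
    by (simp add: mult.assoc flip: exp_add)
  then have j: "exp (- (\<kappa> * (x - y)\<^sup>2)) * (?j ^ N)\<^sup>2 \<le> exp \<kappa> / (\<kappa> / real N) ^ N"
    using pos N by (simp add: pos_le_divide_eq mult_ac)
  have "(norm (h (x, y)) * ?j ^ N)\<^sup>2 \<le> c * exp (- (\<kappa> * (x - y)\<^sup>2)) * (?j ^ N)\<^sup>2"
    unfolding power_mult_distrib by (intro mult_right_mono h) simp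
  also have "\<dots> \<le> c * (exp \<kappa> / (\<kappa> / real N) ^ N)"
    unfolding mult.assoc using pos by (intro mult_left_mono j) simp
  finally have "norm (h (x, y)) * ?j ^ N \<le> ?K"
    by (intro real_le_rsqrt) simp
  then show "norm (h (x, y)) \<le> ?K * ?j powi (- int N)"
    using japanese_pos[of "x - y"] by (simp add: power_int_minus field_simps)
qed

text \<open>Gaussians depend continuously in \<open>L\<^sup>2\<close> on their centre, a unitary
  \<open>U\<close> preserves their distances, and Cauchy-Schwarz transfers this to the
  pairing.\<close>

lemma continuous_unitary_gaussian:
  fixes U :: "(real \<Rightarrow> complex) \<Rightarrow> real \<Rightarrow> complex"
  assumes U: "unitary_on_L2 U"
  shows "continuous_on UNIV (\<lambda>(x, y). LINT t|lborel. U (\<lambda>s. gaussian (y - s)) t * gaussian (x - t))"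
proof -
  define G :: "real \<Rightarrow> real \<Rightarrow> complex" where "G = (\<lambda>x t. gaussian (x - t))"
  have G: "G x \<in> L2" for x
    unfolding G_def by (rule gaussian_at_L2)
  have UG: "U (G x) \<in> L2" for x
    by (rule unitary_on_L2_mem[OF U G])
  \<comment> \<open>\<open>d s\<close> is the squared \<open>L\<^sup>2\<close> distance of two
    Gaussians whose centres differ by \<open>s\<close>.\<close>
  define d where "d = (\<lambda>s::real. 2 * (1 - exp (- pi * s\<^sup>2 / 2)) / sqrt 2)"
  have inner: "L2_inner (G x) (G y) = of_real (exp (- pi * (x - y)\<^sup>2 / 2) / sqrt 2)" for x y
    unfolding G_def by (rule L2_inner_gaussian)
  have norm1: "(LINT t|lborel. (norm (f t))\<^sup>2) \<le> 1" if "L2_inner f f = L2_inner (G x) (G x)" for f x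
  proof -
    have "complex_of_real (LINT t|lborel. (norm (f t))\<^sup>2) = L2_inner f f"
      by (simp add: L2_inner_def complex_norm_square flip: integral_complex_of_real del: of_real_power)
    also have "\<dots> = of_real (1 / sqrt 2)"
      unfolding that inner by simp
    finally show ?thesis
      by (simp only: of_real_eq_iff) simp
  qed
  \<comment> \<open>Only inner products are prescribed, so the formula covers both the Gaussians and
    their images under \<open>U\<close>.\<close>
  have diff: "(LINT t|lborel. (norm (f t - g t))\<^sup>2) = d (x - y)"
    if "f \<in> L2" "g \<in> L2" "L2_inner f f = L2_inner (G x) (G x)" "L2_inner g g = L2_inner (G y) (G y)"
      "L2_inner f g = L2_inner (G x) (G y)" "L2_inner g f = L2_inner (G y) (G x)" for f g x y
    unfolding integral_norm_diff_L2[OF that(1,2)] that(3-) inner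
    by (simp add: d_def power2_commute[of y x] field_simps)
  have d_nonneg: "d s \<ge> 0" for s
    by (simp add: d_def)
  have bound: "norm (LINT t|lborel. f t * g t) \<le> sqrt u"
    if "f \<in> L2" "g \<in> L2"
      "(LINT t|lborel. (norm (f t))\<^sup>2) * (LINT t|lborel. (norm (g t))\<^sup>2) \<le> u"
    for f g :: "real \<Rightarrow> complex" and u
    using Cauchy_Schwarz_L2[OF that(1,2)] that(3) by (intro real_le_rsqrt) linarith
  define h where "h = (\<lambda>z. LINT t|lborel. U (G (snd z)) t * G (fst z) t)"
  have h_diff: "norm (h z - h w) \<le> sqrt (d (snd z - snd w)) + sqrt (d (fst z - fst w))" for z w
  proof -
    have "h z - h w = (LINT t|lborel. U (G (snd z)) t * G (fst z) t - U (G (snd w)) t * G (fst w) t)"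
      unfolding h_def by (intro Bochner_Integration.integral_diff[symmetric] integrable_L2_mult G UG)
    also have "\<dots> = (LINT t|lborel. (U (G (snd z)) t - U (G (snd w)) t) * G (fst z) t
        + U (G (snd w)) t * (G (fst z) t - G (fst w) t))"
      by (simp add: algebra_simps)
    also have "\<dots> = (LINT t|lborel. (U (G (snd z)) t - U (G (snd w)) t) * G (fst z) t)
        + (LINT t|lborel. U (G (snd w)) t * (G (fst z) t - G (fst w) t))"
      by (intro Bochner_Integration.integral_add integrable_L2_mult L2_diff G UG)
    finally have "norm (h z - h w) \<le> norm (LINT t|lborel. (U (G (snd z)) t - U (G (snd w)) t) * G (fst z) t)
        + norm (LINT t|lborel. U (G (snd w)) t * (G (fst z) t - G (fst w) t))"
      by (simp add: norm_triangle_ineq)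
    also have "\<dots> \<le> sqrt (d (snd z - snd w)) + sqrt (d (fst z - fst w))"
    proof (intro add_mono bound L2_diff G UG)
      show "(LINT t|lborel. (norm (U (G (snd z)) t - U (G (snd w)) t))\<^sup>2) * (LINT t|lborel. (norm (G (fst z) t))\<^sup>2)
          \<le> d (snd z - snd w)"
        by (subst diff[OF UG UG])
          (auto simp: unitary_on_L2_inner[OF U G G] intro!: mult_left_le norm1 d_nonneg)
      show "(LINT t|lborel. (norm (U (G (snd w)) t))\<^sup>2) * (LINT t|lborel. (norm (G (fst z) t - G (fst w) t))\<^sup>2)
          \<le> d (fst z - fst w)"
        by (subst diff[OF G G])
          (auto simp: unitary_on_L2_inner[OF U G G] intro!: mult_left_le_one_le norm1 d_nonneg)
    qed
    finally show ?thesis .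
  qed
  have "continuous (at w) h" for w
  proof -
    have "((\<lambda>z. sqrt (d (snd z - snd w)) + sqrt (d (fst z - fst w))) \<longlongrightarrow>
        sqrt (d (snd w - snd w)) + sqrt (d (fst w - fst w))) (at w)"
      unfolding d_def by (intro tendsto_intros) auto
    then have "((\<lambda>z. sqrt (d (snd z - snd w)) + sqrt (d (fst z - fst w))) \<longlongrightarrow> 0) (at w)"
      by (simp add: d_def)
    then have "((\<lambda>z. h z - h w) \<longlongrightarrow> 0) (at w)"
      by (rule Lim_null_comparison[rotated]) (simp add: h_diff)
    then show ?thesis
      by (simp add: continuous_at LIM_zero_iff)
  qed
  then have "continuous_on UNIV h"
    by (simp add: continuous_at_imp_continuous_on)
  then show ?thesis
    by (simp add: h_def G_def case_prod_unfold)
qed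

text \<open>The Gaussian on the plane factors, so the test function is a tensor product of
  one-dimensional Gaussians, to which the defining property of the kernel applies.\<close>

lemma smoothed_kernel_eq:
  fixes x y :: real
  assumes "is_schwartz_kernel (\<lambda>f. distribution_of (U f)) k"
  shows "distr_convolution k gaussian (x, y)
    = (LINT t|lborel. U (\<lambda>s. gaussian (y - s)) t * gaussian (x - t))"
proof -
  have "gaussian ((x, y) - w) = (case w of (s, t) \<Rightarrow> gaussian (x - s) * gaussian (y - t))" for w
    by (cases w) (simp add: gaussian_def norm_Pair algebra_simps flip: exp_add of_real_mult)
  then have "distr_convolution k gaussian (x, y) = k (\<lambda>(s, t). gaussian (x - s) * gaussian (y - t))"
    by (simp add: distr_convolution_def)
  also have "\<dots> = distribution_of (U (\<lambda>s. gaussian (y - s))) (\<lambda>t. gaussian (x - t))"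
    using assms gaussian_at_schwartz unfolding is_schwartz_kernel_def by metis
  finally show ?thesis
    by (simp add: distribution_of_def)
qed

section \<open>From the Gaussian modulus to the criterion on \<open>C\<close> and
  \<open>D\<close>\<close>

theorem proposition1p4:
  fixes A B C D :: real
    and U :: "(real \<Rightarrow> complex) \<Rightarrow> real \<Rightarrow> complex"
    and k :: "(real \<times> real \<Rightarrow> complex) \<Rightarrow> complex"
  assumes "A * D - B * C = 1"
    and "metaplectic (matrix_map A B C D) U"
    and "is_schwartz_kernel (\<lambda>f. distribution_of (U f)) k"
  shows "quasi_diagonal k \<longleftrightarrow> D = 1 \<or> C \<noteq> 0"
proof -
  define b where "b = B * D + A * C"
  define e where "e = 1 + A\<^sup>2 + B\<^sup>2"
  define \<delta> where "\<delta> = 1 + C\<^sup>2 + D\<^sup>2 - b\<^sup>2 / e"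
  define h where "h = distr_convolution k gaussian"
  define X where "X = (\<lambda>x y. A * y - x)"
  define Z where "Z = (\<lambda>x y. b / e * X x y - C * y)"
  note formula = norm_metaplectic_gaussian[OF assms(1,2), folded b_def e_def, folded \<delta>_def]
  have e: "e > 0"
    unfolding e_def using zero_le_power2[of A] zero_le_power2[of B] by linarith
  have \<delta>: "\<delta> > 0"
    by (rule formula(1))
  have q: "sqrt (e * \<delta>) > 0"
    using e \<delta> by simp
  have h: "(norm (h (x, y)))\<^sup>2 = exp (- (2 * pi / e * (X x y)\<^sup>2) - 2 * pi / \<delta> * (Z x y)\<^sup>2) / sqrt (e * \<delta>)" for x y
    unfolding h_def smoothed_kernel_eq[OF assms(3)] X_def Z_def by (rule formula(2))
  have "h = (\<lambda>(x, y). LINT t|lborel. U (\<lambda>s. gaussian (y - s)) t * gaussian (x - t))"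
    by (auto simp: fun_eq_iff h_def smoothed_kernel_eq[OF assms(3)])
  then have cont: "continuous_on UNIV h"
    using continuous_unitary_gaussian[OF metaplectic_unitary[OF assms(2)]] by (simp only:)
  show ?thesis
  proof
    assume "quasi_diagonal k"
    then obtain K where K: "\<And>x y. norm (h (x, y)) \<le> K * japanese (x - y) powi (- int 1)"
      unfolding quasi_diagonal_def diagonal_kernel_def h_def by (metis zero_less_one)
    show "D = 1 \<or> C \<noteq> 0"
    proof (rule ccontr)
      assume "\<not> ?thesis"
      then have C: "C = 0" and "D \<noteq> 1" by auto
      with assms(1) have A: "A - 1 \<noteq> 0" by auto
      \<comment> \<open>For \<open>C = 0\<close> both \<open>X\<close> and \<open>Z\<close> vanish
        on the line \<open>x = A * y\<close>, so \<open>h\<close> has constant modulus there. The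
        point is chosen with \<open>x - y = v\<close>, and \<open>v\<close> so that the squared
        decay bound of order 1 becomes \<open>1 + v\<^sup>2 \<le> v\<close>, which is
        impossible.\<close>
      define v where "v = K\<^sup>2 * sqrt (e * \<delta>)"
      define y where "y = v / (A - 1)"
      have j: "(japanese (A * y - y))\<^sup>2 = 1 + v\<^sup>2"
      proof -
        have "A * y - y = (A - 1) * y"
          by (simp add: algebra_simps)
        also have "\<dots> = v"
          using A by (simp add: y_def)
        finally show ?thesis
          by (simp only: japanese_real_sq)
      qed
      have "norm (h (A * y, y)) * japanese (A * y - y) \<le> K"
        using K[of "A * y" y] japanese_pos[of "A * y - y"] by (simp add: power_int_minus field_simps)
      then have "(norm (h (A * y, y)) * japanese (A * y - y))\<^sup>2 \<le> K\<^sup>2"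
        by (rule power_mono) (simp add: less_imp_le japanese_pos)
      then have "1 / sqrt (e * \<delta>) * (1 + v\<^sup>2) \<le> K\<^sup>2"
        unfolding power_mult_distrib h j by (simp add: X_def Z_def C)
      then have "1 + v\<^sup>2 \<le> v"
        using q by (simp add: v_def field_simps)
      moreover have "2 * v \<le> 1 + v\<^sup>2"
        using sum_squares_bound[of v 1] by simp
      moreover have "0 \<le> v\<^sup>2" by simp
      ultimately show False by linarith
    qed
  next
    assume CD: "D = 1 \<or> C \<noteq> 0"
    have "\<exists>\<alpha> \<mu>. \<forall>x y. x - y = \<alpha> * X x y + \<mu> * Z x y"
    proof (cases "C = 0")
      case True
      with CD assms(1) have "A = 1" by simp
      then show ?thesis
        by (intro exI[of _ "-1"] exI[of _ 0]) (simp add: X_def)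
    next
      case False
      \<comment> \<open>Here \<open>x - y = - X + (A - 1) * y\<close> and
        \<open>C * y = b / e * X - Z\<close>; multiplying the latter by \<open>m\<close> eliminates
        \<open>y\<close>.\<close>
      define m where "m = (A - 1) / C"
      have "x - y = (- 1 + m * (b / e)) * X x y + - m * Z x y" for x y
      proof -
        have "(- 1 + m * (b / e)) * X x y + - m * Z x y = - X x y + (m * C) * y"
          by (simp add: Z_def algebra_simps)
        also have "m * C = A - 1"
          using False by (simp add: m_def)
        finally show ?thesis
          by (simp add: X_def algebra_simps)
      qed
      then show ?thesis by blast
    qed
    then obtain \<alpha> \<mu> where lin: "\<And>x y. x - y = \<alpha> * X x y + \<mu> * Z x y" by blast
    \<comment> \<open>\<open>L\<close> dominates both coefficients that arise when
      \<open>(x - y)\<^sup>2\<close> is compared with the two terms of the exponent of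
      \<open>h\<close>; the summand 1 ensures that it is positive.\<close>
    define L where "L = 1 + \<alpha>\<^sup>2 * e / pi + \<mu>\<^sup>2 * \<delta> / pi"
    have L: "L > 0"
      using e \<delta> unfolding L_def by (intro add_pos_nonneg) auto
    have "(norm (h (x, y)))\<^sup>2 \<le> 1 / sqrt (e * \<delta>) * exp (- (1 / L * (x - y)\<^sup>2))" for x y
    proof -
      let ?X = "X x y" and ?Z = "Z x y"
      have "(x - y)\<^sup>2 \<le> 2 * (\<alpha> * ?X)\<^sup>2 + 2 * (\<mu> * ?Z)\<^sup>2"
        unfolding lin using sum_squares_bound[of "\<alpha> * ?X" "\<mu> * ?Z"] by (simp add: power2_sum)
      also have "\<dots> = \<alpha>\<^sup>2 * e / pi * (2 * pi / e * ?X\<^sup>2) + \<mu>\<^sup>2 * \<delta> / pi * (2 * pi / \<delta> * ?Z\<^sup>2)"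
        using e \<delta> by (simp add: power_mult_distrib)
      also have "\<dots> \<le> L * (2 * pi / e * ?X\<^sup>2) + L * (2 * pi / \<delta> * ?Z\<^sup>2)"
        using e \<delta> by (intro add_mono mult_right_mono) (auto simp: L_def add_increasing add_increasing2)
      finally have "1 / L * (x - y)\<^sup>2 \<le> 2 * pi / e * ?X\<^sup>2 + 2 * pi / \<delta> * ?Z\<^sup>2"
        using L by (simp add: field_simps)
      then show ?thesis
        unfolding h using q by (simp add: divide_right_mono)
    qed
    then have "\<exists>K>0. \<forall>x y. norm (h (x, y)) \<le> K * japanese (x - y) powi (- int N)" if "N > 0" for N
      using gaussian_bound_imp_diagonal_bound[of "1 / sqrt (e * \<delta>)" "1 / L" N h] q L that by simp
    with cont show "quasi_diagonal k"
      by (auto simp: quasi_diagonal_def diagonal_kernel_def h_def)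
  qed
qed

end
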